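(* Fix students $I$, colleges $C$, capacities, scores and a number of rounds $T\ge1$, and fix an arbitrary probability distribution $\mathbb{P}$ over preference profiles $\succ=(\succ_i)_{i\in I}$. Suppose that students follow straightforward strategies under the $T$-round time-constrained dynamic mechanism (TCDM) and report their preferences truthfully under student-proposing deferred acceptance (DA). Then, for every student $i$: 1. If student $i$ is $T$-unconstrained, then $p^{TCDM}_{i,l}=p^{DA}_{i,l}$ for every $l\in\{1,\dots,|C|\}$, and $p^{TCDM}_{i,\emptyset}=p^{DA}_{i,\emptyset}$. 2. $p^{TCDM}_{i,1}\ge p^{DA}_{i,1}$. If, in addition, every student prefers every college to the outside option (for every preference profile in the domain on which $\mathbb{P}$ is defined) and $\sum_{c\in C}q_c\ge |I|$, then, for every student $i$: 3. $p^{TCDM}_{i,\emptyset}\ge p^{DA}_{i,\emptyset}=0$. 4. $\sum_{l=2}^{|C|}p^{TCDM}_{i,l}\le\sum_{l=2}^{|C|}p^{DA}_{i,l}$.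
   Context: Problem. $I$ is a finite set of students and $C$ a finite set of colleges. A preference profile is $\succ=(\succ_i)_{i\in I}$, where each $\succ_i$ is a strict linear order over $C\cup\{\emptyset\}$ and $\emptyset$ is the outside option (being unassigned); $c$ is acceptable to $i$ if $c\succ_i\emptyset$. Each college $c$ has capacity $q_c\in\mathbb{N}_+$. Each student has a score $s_i>0$, scores are distinct, and every college uses the common strict priority order $i\triangleright j\iff s_i>s_j$. A matching is a map $\mu:I\to C\cup\{\emptyset\}$ with $|\mu^{-1}(c)|\le q_c$ for all $c$. The cutoff of $c$ at $\mu$ is $f_c(\mu)=\min\{s_i:i\in\mu^{-1}(c)\}$ if $|\mu^{-1}(c)|=q_c$, and $f_c(\mu)=0$ otherwise. DA (student-proposing deferred acceptance), with outcome $\mu^{DA}(\succ)$. Step 1: each student applies to her most-preferred acceptable college (if any); each college tentatively holds its highest-priority applicants up to capacity and rejects the rest. Each later step: every student rejected in the preceding step applies to her next most-preferred acceptable college (if any); each college holds the highest-priority students up to capacity among those it was holding and its new applicants, and rejects the rest. It ends when no further rejection occurs; tentative acceptances become final and all other students are unassigned. TCDM, with outcome $\mu^{TCDM}(\succ)=\mu^T$. In each round $t=1,\dots,T$ every student chooses one element of $C\cup\{\emptyset\}$ (replacing any earlier application). Given the current application profile, each college tentatively holds its highest-priority current applicants up to capacity and rejects the others; this defines the tentative matching $\mu^t$ (students who are rejected or chose $\emptyset$ are unassigned). Straightforward strategy. In round 1 student $i$ applies to her $\succ_i$-best element of $C\cup\{\emptyset\}$. In round $t>1$: if $\mu^{t-1}(i)\in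 C$, she applies again to $\mu^{t-1}(i)$; if $\mu^{t-1}(i)=\emptyset$, she chooses her $\succ_i$-best element of $\{c\in C: s_i\ge f_c(\mu^{t-1})\}\cup\{\emptyset\}$. $T$-unconstrained. Student $i$ is $T$-unconstrained if $\mu^{TCDM}(\succ)(i)=\mu^{DA}(\succ)(i)$ for every preference profile $\succ$ (in the domain of profiles considered). Probabilities. Let $c_i^l(\succ_i)$ be student $i$'s $l$-th-ranked college under $\succ_i$. For $M\in\{TCDM,DA\}$, $p^{M}_{i,l}=\mathbb{P}(\mu^{M}(\succ)(i)=c_i^l(\succ_i))$ and $p^{M}_{i,\emptyset}=\mathbb{P}(\mu^{M}(\succ)(i)=\emptyset)$. *)

theory Defs
  imports "HOL-Probability.Probability_Mass_Function" "HOL-Library.While_Combinator"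
begin

text \<open>
  Students and colleges are the elements of two finite types. The outside option is \<open>None\<close>, and
  \<open>(x, y) \<in> r\<close> reads: \<open>x\<close> is strictly preferred to \<open>y\<close>.
\<close>

type_synonym 'c pref = "'c option rel"
type_synonym ('i, 'c) profile = "'i \<Rightarrow> 'c pref"
type_synonym ('i, 'c) assignment = "'i \<Rightarrow> 'c option"

definition preference_profile :: "('i, 'c) profile \<Rightarrow> bool" where
  "preference_profile pr \<longleftrightarrow> (\<forall>i. strict_linear_order_on UNIV (pr i))"

definition acceptable :: "'c pref \<Rightarrow> 'c \<Rightarrow> bool" where
  "acceptable r c \<longleftrightarrow> (Some c, None) \<in> r"

text \<open>The best element of \<open>A\<close> together with the outside option; it is the most-preferred acceptable
  college of \<open>A\<close> if there is one, and \<open>None\<close> otherwise.\<close>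

definition best :: "'c pref \<Rightarrow> 'c set \<Rightarrow> 'c option" where
  "best r A = (THE x. x \<in> insert None (Some ` A) \<and>
                      (\<forall>y \<in> insert None (Some ` A). y \<noteq> x \<longrightarrow> (x, y) \<in> r))"

definition ranked_college :: "'c pref \<Rightarrow> nat \<Rightarrow> 'c" where
  "ranked_college r l = (THE c. card {d. (Some d, Some c) \<in> r} + 1 = l)"

definition cutoff :: "('c \<Rightarrow> nat) \<Rightarrow> ('i \<Rightarrow> real) \<Rightarrow> ('i, 'c) assignment \<Rightarrow> 'c \<Rightarrow> real" where
  "cutoff q s \<mu> c =
     (if card {i. \<mu> i = Some c} = q c then Min (s ` {i. \<mu> i = Some c}) else 0)"

text \<open>The \<open>n\<close> highest-priority members of \<open>A\<close>, or all of \<open>A\<close> if it has at most \<open>n\<close> elements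
  (for distinct scores).\<close>

definition top_priority :: "('i \<Rightarrow> real) \<Rightarrow> nat \<Rightarrow> 'i set \<Rightarrow> 'i set" where
  "top_priority s n A = {i \<in> A. card {j \<in> A. s j > s i} < n}"

text \<open>\<open>a\<close> is an application profile; students who are rejected or chose \<open>None\<close> are unassigned.\<close>

definition tentative ::
  "('c \<Rightarrow> nat) \<Rightarrow> ('i \<Rightarrow> real) \<Rightarrow> ('i, 'c) assignment \<Rightarrow> ('i, 'c) assignment" where
  "tentative q s a i =
     (case a i of
        None \<Rightarrow> None
      | Some c \<Rightarrow> if i \<in> top_priority s (q c) {j. a j = Some c} then Some c else None)"

subsection \<open>Deferred acceptance\<close>

text \<open>
  The state is the profile \<open>a\<close> of current applications: a student who is tentatively held stays with
  her college, a student rejected by \<open>c\<close> moves to her next most-preferred acceptable college below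
  \<open>c\<close>, and \<open>None\<close> means that her list of acceptable colleges is exhausted. So the students with
  \<open>a j = Some c\<close> are those held by \<open>c\<close> together with its new applicants. Nobody is rejected exactly
  when \<open>tentative q s a = a\<close>.
\<close>

definition da_step ::
  "('c \<Rightarrow> nat) \<Rightarrow> ('i \<Rightarrow> real) \<Rightarrow> ('i, 'c) profile \<Rightarrow> ('i, 'c) assignment \<Rightarrow> ('i, 'c) assignment" where
  "da_step q s pr a i =
     (if tentative q s a i = a i then a i
      else best (pr i) {d. (a i, Some d) \<in> pr i})"

definition da :: "('c \<Rightarrow> nat) \<Rightarrow> ('i \<Rightarrow> real) \<Rightarrow> ('i, 'c) profile \<Rightarrow> ('i, 'c) assignment" where
  "da q s pr =
     tentative q s
       (while (\<lambda>a. tentative q s a \<noteq> a) (da_step q s pr) (\<lambda>i. best (pr i) UNIV))"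

subsection \<open>The time-constrained dynamic mechanism\<close>

text \<open>A strategy maps the list of past tentative matchings, latest first, to the next choice; the
  empty list is the history before round 1.\<close>

type_synonym ('i, 'c) strategy = "('i, 'c) assignment list \<Rightarrow> 'c option"

primrec tcdm_history ::
  "('c \<Rightarrow> nat) \<Rightarrow> ('i \<Rightarrow> real) \<Rightarrow> ('i \<Rightarrow> ('i, 'c) strategy) \<Rightarrow> nat \<Rightarrow> ('i, 'c) assignment list" where
  "tcdm_history q s \<sigma> 0 = []"
| "tcdm_history q s \<sigma> (Suc t) =
     tentative q s (\<lambda>i. \<sigma> i (tcdm_history q s \<sigma> t)) # tcdm_history q s \<sigma> t"

fun straightforward ::
  "('c \<Rightarrow> nat) \<Rightarrow> ('i \<Rightarrow> real) \<Rightarrow> 'c pref \<Rightarrow> 'i \<Rightarrow> ('i, 'c) strategy" where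
  "straightforward q s r i [] = best r UNIV"
| "straightforward q s r i (\<mu> # h) =
     (case \<mu> i of
        Some c \<Rightarrow> Some c
      | None \<Rightarrow> best r {c. s i \<ge> cutoff q s \<mu> c})"

text \<open>The outcome of \<open>T \<ge> 1\<close> rounds under straightforward strategies.\<close>

definition tcdm ::
  "('c \<Rightarrow> nat) \<Rightarrow> ('i \<Rightarrow> real) \<Rightarrow> nat \<Rightarrow> ('i, 'c) profile \<Rightarrow> ('i, 'c) assignment" where
  "tcdm q s T pr = hd (tcdm_history q s (\<lambda>i. straightforward q s (pr i) i) T)"

definition unconstrained ::
  "('c \<Rightarrow> nat) \<Rightarrow> ('i \<Rightarrow> real) \<Rightarrow> ('i, 'c) profile set \<Rightarrow> nat \<Rightarrow> 'i \<Rightarrow> bool" where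
  "unconstrained q s D T i \<longleftrightarrow> (\<forall>pr \<in> D. tcdm q s T pr i = da q s pr i)"

subsection \<open>Assignment probabilities of a mechanism\<close>

definition rank_prob ::
  "('i, 'c) profile pmf \<Rightarrow> (('i, 'c) profile \<Rightarrow> ('i, 'c) assignment) \<Rightarrow> 'i \<Rightarrow> nat \<Rightarrow> real" where
  "rank_prob P M i l = measure_pmf.prob P {pr. M pr i = Some (ranked_college (pr i) l)}"

definition unassigned_prob ::
  "('i, 'c) profile pmf \<Rightarrow> (('i, 'c) profile \<Rightarrow> ('i, 'c) assignment) \<Rightarrow> 'i \<Rightarrow> real" where
  "unassigned_prob P M i = measure_pmf.prob P {pr. M pr i = None}"

end

theory Submission imports Defs begin

text \<open>
  The DA outcome \<open>m\<close> has no justified envy. By induction on the rounds of TCDM, every student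
  applies to something she likes at least as much as \<open>m i\<close>, and \<open>m i\<close> itself stays within her
  reach: if \<open>q c\<close> current applicants of \<open>c = m i\<close> had a higher score than \<open>i\<close>, not all of them could
  be matched to \<open>c\<close> under \<open>m\<close>, so one of them would envy \<open>i\<close>. Hence a student whose DA assignment
  is her favourite college keeps that college in TCDM. The two claims under universal
  acceptability and sufficient capacity then follow because DA is non-wasteful and therefore
  leaves nobody unassigned.
\<close>

section \<open>Best choices under a linear order and selection by priority\<close>

definition weakly_prefers :: "'c pref \<Rightarrow> 'c option \<Rightarrow> 'c option \<Rightarrow> bool" where
  "weakly_prefers r x y \<longleftrightarrow> x = y \<or> (x, y) \<in> r"

text \<open>Makes the definite description in \<open>best\<close> denote. Existence is by induction
  on the set, comparing the new element with the old greatest one; two distinct greatest elements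
  would each be preferred to the other.\<close>

lemma strict_linear_order_greatest:
  assumes r: "strict_linear_order_on UNIV r" and "finite A" "A \<noteq> {}"
  shows "\<exists>!x. x \<in> A \<and> (\<forall>y\<in>A. y \<noteq> x \<longrightarrow> (x, y) \<in> r)"
proof -
  have t: "trans r" and ir: "irrefl r" and tot: "total r"
    using r by (auto simp: strict_linear_order_on_def)
  have "\<exists>x\<in>A. \<forall>y\<in>A. y \<noteq> x \<longrightarrow> (x, y) \<in> r"
    using assms(2,3)
  proof (induction A rule: finite_ne_induct)
    case (singleton x)
    then show ?case by simp
  next
    case (insert a A)
    then obtain x where x: "x \<in> A" "\<forall>y\<in>A. y \<noteq> x \<longrightarrow> (x, y) \<in> r" by blast
    have "a \<noteq> x" using x(1) insert.hyps by blast
    then consider "(a, x) \<in> r" | "(x, a) \<in> r"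
      using tot by (auto simp: total_on_def)
    then show ?case
    proof cases
      case 1
      then have "\<forall>y\<in>insert a A. y \<noteq> a \<longrightarrow> (a, y) \<in> r"
        using x t by (metis insert_iff transD)
      then show ?thesis by blast
    next
      case 2
      then show ?thesis using x by blast
    qed
  qed
  moreover have "x = y" if "x \<in> A" "\<forall>y\<in>A. y \<noteq> x \<longrightarrow> (x, y) \<in> r"
    "y \<in> A" "\<forall>x\<in>A. x \<noteq> y \<longrightarrow> (y, x) \<in> r" for x y
    using that t ir by (metis irrefl_def transD)
  ultimately show ?thesis by blast
qed

lemma best_greatest:
  fixes r :: "('c::finite) pref"
  assumes "strict_linear_order_on UNIV r"
  shows "best r A \<in> insert None (Some ` A)"
    and "x \<in> insert None (Some ` A) \<Longrightarrow> weakly_prefers r (best r A) x"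
proof -
  have "\<exists>!x. x \<in> insert None (Some ` A) \<and> (\<forall>y\<in>insert None (Some ` A). y \<noteq> x \<longrightarrow> (x, y) \<in> r)"
    by (rule strict_linear_order_greatest[OF assms]) auto
  from theI'[OF this] have *: "best r A \<in> insert None (Some ` A) \<and>
      (\<forall>y\<in>insert None (Some ` A). y \<noteq> best r A \<longrightarrow> (best r A, y) \<in> r)"
    unfolding best_def .
  from * show "best r A \<in> insert None (Some ` A)" by blast
  from * show "x \<in> insert None (Some ` A) \<Longrightarrow> weakly_prefers r (best r A) x"
    unfolding weakly_prefers_def by metis
qed

text \<open>This is why a full college stays full while DA runs. If nobody above \<open>x\<close> is
  rejected, the count does not change; if somebody is, the rejection itself certifies
  \<open>n\<close> candidates with a still higher score.\<close>

lemma card_top_priority_above: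
  assumes "finite A" and n: "n \<le> card {j \<in> A. s j > x}"
  shows "n \<le> card {j \<in> top_priority s n A. s j > x}"
proof (cases "{j \<in> A. s j > x} \<subseteq> top_priority s n A")
  case True
  then have "{j \<in> A. s j > x} = {j \<in> top_priority s n A. s j > x}"
    by (auto simp: top_priority_def)
  then show ?thesis using n by simp
next
  case False
  define R where "R = {j \<in> A. s j > x} - top_priority s n A"
  have R: "finite R" "R \<noteq> {}" using assms(1) False by (auto simp: R_def)
  \<comment> \<open>Everybody above the best rejected member of \<open>A\<close> is kept, and there are at least \<open>n\<close> of them.\<close>
  obtain j where j: "j \<in> R" "\<And>k. k \<in> R \<Longrightarrow> s k \<le> s j"
  proof -
    from R have "Max (s ` R) \<in> s ` R" by (intro Max_in) auto
    then obtain j where "j \<in> R" "s j = Max (s ` R)" by auto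
    moreover have "s k \<le> Max (s ` R)" if "k \<in> R" for k using that R by (intro Max_ge) auto
    ultimately show thesis using that by auto
  qed
  have "n \<le> card {k \<in> A. s k > s j}"
    using j(1) by (auto simp: R_def top_priority_def not_less)
  also have "\<dots> \<le> card {k \<in> top_priority s n A. s k > x}"
  proof (rule card_mono)
    show "finite {k \<in> top_priority s n A. s k > x}"
      using assms(1) by (auto simp: top_priority_def)
    show "{k \<in> A. s k > s j} \<subseteq> {k \<in> top_priority s n A. s k > x}"
    proof
      fix k assume k: "k \<in> {k \<in> A. s k > s j}"
      then have "s k > x" using j(1) by (auto simp: R_def)
      moreover have "k \<notin> R" using k j(2)[of k] by auto
      ultimately show "k \<in> {k \<in> top_priority s n A. s k > x}"
        using k by (auto simp: R_def)
    qed
  qed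
  finally show ?thesis .
qed

lemma tentative_cases: "tentative q s a i = a i \<or> tentative q s a i = None"
  by (auto simp: tentative_def split: option.splits)

lemma tentative_eq_Some_iff:
  "tentative q s a i = Some c \<longleftrightarrow> a i = Some c \<and> card {j. a j = Some c \<and> s j > s i} < q c"
  by (auto simp: tentative_def top_priority_def split: option.splits)

subsection \<open>Stability of deferred acceptance\<close>

text \<open>Every college that a student has already moved past is filled with applicants of higher
  priority.\<close>

definition da_invariant ::
  "('c \<Rightarrow> nat) \<Rightarrow> ('i \<Rightarrow> real) \<Rightarrow> ('i, 'c) profile \<Rightarrow> ('i, 'c) assignment \<Rightarrow> bool" where
  "da_invariant q s pr a \<longleftrightarrow>
     (\<forall>i. weakly_prefers (pr i) (a i) None) \<and>
     (\<forall>i c. (Some c, a i) \<in> pr i \<longrightarrow> q c \<le> card {j. a j = Some c \<and> s j > s i})"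

lemma da_invariantD:
  assumes "da_invariant q s pr a"
  shows "weakly_prefers (pr i) (a i) None"
    and "(Some c, a i) \<in> pr i \<Longrightarrow> q c \<le> card {j. a j = Some c \<and> s j > s i}"
  using assms unfolding da_invariant_def by blast+

text \<open>No college is ranked above the best of all options, so the second clause of the
  invariant is vacuous.\<close>

lemma da_invariant_initial:
  fixes pr :: "('i, 'c::finite) profile"
  assumes "preference_profile pr"
  shows "da_invariant q s pr (\<lambda>i. best (pr i) UNIV)"
  unfolding da_invariant_def
proof (intro conjI allI impI)
  fix i
  have r: "strict_linear_order_on UNIV (pr i)"
    using assms by (auto simp: preference_profile_def)
  show "weakly_prefers (pr i) (best (pr i) UNIV) None"
    by (rule best_greatest[OF r]) simp
  fix c assume "(Some c, best (pr i) UNIV) \<in> pr i"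
  moreover have "weakly_prefers (pr i) (best (pr i) UNIV) (Some c)"
    by (rule best_greatest[OF r]) simp
  ultimately have False
    using r unfolding weakly_prefers_def strict_linear_order_on_def
    by (metis irrefl_def transD)
  then show "q c \<le> card {j. best (pr j) UNIV = Some c \<and> s j > s i}" ..
qed

text \<open>Held students repeat their application, so the selection made by \<open>c\<close> is
  contained in its next set of applicants; newcomers can only add to the count.\<close>

lemma card_applicants_above_da_step:
  fixes a :: "('i::finite, 'c) assignment"
  assumes "n = q c" "n \<le> card {j. a j = Some c \<and> s j > x}"
  shows "n \<le> card {j. da_step q s pr a j = Some c \<and> s j > x}"
proof -
  have "n \<le> card {j \<in> top_priority s n {j. a j = Some c}. s j > x}"
    using assms by (intro card_top_priority_above) auto
  also have "\<dots> \<le> card {j. da_step q s pr a j = Some c \<and> s j > x}"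
    using assms(1)
    by (intro card_mono) (auto simp: da_step_def tentative_def top_priority_def)
  finally show ?thesis .
qed

text \<open>Collects, as one elimination rule, what a rejection reveals: the rejecting college is
  full above the student, and her next choice is the best option strictly below it.\<close>

lemma da_step_rejected:
  fixes pr :: "('i, 'c::finite) profile"
  assumes "preference_profile pr" "da_invariant q s pr a" "tentative q s a i \<noteq> a i"
  obtains d where "a i = Some d" "q d \<le> card {j. a j = Some d \<and> s j > s i}"
    "(a i, da_step q s pr a i) \<in> pr i"
    "weakly_prefers (pr i) (da_step q s pr a i) None"
    "\<And>c. (a i, Some c) \<in> pr i \<Longrightarrow> weakly_prefers (pr i) (da_step q s pr a i) (Some c)"
proof -
  have r: "strict_linear_order_on UNIV (pr i)"
    using assms(1) by (auto simp: preference_profile_def)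
  obtain d where d: "a i = Some d"
    using assms(3) tentative_cases[of q s a i] by (cases "a i") auto
  have step: "da_step q s pr a i = best (pr i) {d. (a i, Some d) \<in> pr i}"
    using assms(3) by (simp add: da_step_def)
  \<comment> \<open>The current application is acceptable, so the outside option is also strictly
    below it, and every option that \<open>best\<close> may return is a move downwards.\<close>
  have "(a i, None) \<in> pr i"
    using da_invariantD(1)[OF assms(2), of i] d by (simp add: weakly_prefers_def)
  then have "(a i, da_step q s pr a i) \<in> pr i"
    using best_greatest(1)[OF r, of "{d. (a i, Some d) \<in> pr i}"] step by auto
  moreover have "q d \<le> card {j. a j = Some d \<and> s j > s i}"
    using assms(3) d tentative_eq_Some_iff[of q s a i d] by (simp add: not_less)
  moreover have "weakly_prefers (pr i) (da_step q s pr a i) None"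
    unfolding step by (rule best_greatest[OF r]) simp
  moreover have "weakly_prefers (pr i) (da_step q s pr a i) (Some c)"
    if "(a i, Some c) \<in> pr i" for c
    unfolding step by (rule best_greatest[OF r]) (use that in simp)
  ultimately show ?thesis using that[of d] d by blast
qed

text \<open>A college above the new application is either the one that has just rejected the student
  or one that was already above her old application. Both were full above her before the step, and
  remain so after it.\<close>

lemma da_invariant_step:
  fixes pr :: "('i::finite, 'c::finite) profile"
  assumes pr: "preference_profile pr" and inv: "da_invariant q s pr a"
  shows "da_invariant q s pr (da_step q s pr a)"
  unfolding da_invariant_def
proof (intro conjI allI impI)
  fix i
  have r: "trans (pr i)" "irrefl (pr i)" "total (pr i)"
    using pr by (auto simp: preference_profile_def strict_linear_order_on_def)
  show "weakly_prefers (pr i) (da_step q s pr a i) None"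
  proof (cases "tentative q s a i = a i")
    case True
    then show ?thesis using da_invariantD(1)[OF inv, of i] by (simp add: da_step_def)
  next
    case False
    then show ?thesis by (rule da_step_rejected[OF pr inv])
  qed
  fix c assume c: "(Some c, da_step q s pr a i) \<in> pr i"
  \<comment> \<open>The bound is shown for the old applications first and carried through the step
    at the end.\<close>
  have "q c \<le> card {j. a j = Some c \<and> s j > s i}"
  proof (cases "tentative q s a i = a i")
    case True
    then show ?thesis using da_invariantD(2)[OF inv, of c i] c by (simp add: da_step_def)
  next
    case False
    then show ?thesis
    proof (rule da_step_rejected[OF pr inv])
      fix d
      assume d: "a i = Some d" "q d \<le> card {j. a j = Some d \<and> s j > s i}"
        "\<And>c. (a i, Some c) \<in> pr i \<Longrightarrow> weakly_prefers (pr i) (da_step q s pr a i) (Some c)"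
      have "\<not> weakly_prefers (pr i) (da_step q s pr a i) (Some c)"
        using c r unfolding weakly_prefers_def by (metis irrefl_def transD)
      then have "(a i, Some c) \<notin> pr i" using d(3) by blast
      moreover have "c \<noteq> d \<Longrightarrow> (Some c, a i) \<in> pr i \<or> (a i, Some c) \<in> pr i"
        using r(3) d(1) by (simp add: total_on_def)
      ultimately consider "c = d" | "(Some c, a i) \<in> pr i" by blast
      then show ?thesis
        using d(2) da_invariantD(2)[OF inv, of c i] by cases auto
    qed
  qed
  then show "q c \<le> card {j. da_step q s pr a j = Some c \<and> s j > s i}"
    by (intro card_applicants_above_da_step) auto
qed

text \<open>The termination measure of the DA loop: the number of options below the current
  application, summed over all students. A rejected student moves strictly down her list, and the
  others stay.\<close>

lemma da_step_decreases:
  fixes pr :: "('i::finite, 'c::finite) profile"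
  assumes pr: "preference_profile pr" and inv: "da_invariant q s pr a"
    and "tentative q s a \<noteq> a"
  shows "(\<Sum>i\<in>UNIV. card {x. (da_step q s pr a i, x) \<in> pr i}) < (\<Sum>i\<in>UNIV. card {x. (a i, x) \<in> pr i})"
proof -
  have less: "card {x. (da_step q s pr a i, x) \<in> pr i} < card {x. (a i, x) \<in> pr i}"
    if rej: "tentative q s a i \<noteq> a i" for i
  proof -
    have r: "trans (pr i)" "irrefl (pr i)"
      using pr by (auto simp: preference_profile_def strict_linear_order_on_def)
    have *: "(a i, da_step q s pr a i) \<in> pr i"
      by (rule da_step_rejected[OF pr inv rej])
    have "{x. (da_step q s pr a i, x) \<in> pr i} \<subset> {x. (a i, x) \<in> pr i}"
    proof
      show "{x. (da_step q s pr a i, x) \<in> pr i} \<subseteq> {x. (a i, x) \<in> pr i}"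
        using * r(1) by (blast dest: transD)
      show "{x. (da_step q s pr a i, x) \<in> pr i} \<noteq> {x. (a i, x) \<in> pr i}"
        using * r(2) by (auto simp: irrefl_def)
    qed
    then show ?thesis by (intro psubset_card_mono) auto
  qed
  show ?thesis
  proof (rule sum_strict_mono_ex1)
    show "\<forall>i\<in>UNIV. card {x. (da_step q s pr a i, x) \<in> pr i} \<le> card {x. (a i, x) \<in> pr i}"
    proof
      fix i
      show "card {x. (da_step q s pr a i, x) \<in> pr i} \<le> card {x. (a i, x) \<in> pr i}"
        using less[of i] by (cases "tentative q s a i = a i") (auto simp: da_step_def)
    qed
    show "\<exists>i\<in>UNIV. card {x. (da_step q s pr a i, x) \<in> pr i} < card {x. (a i, x) \<in> pr i}"
    proof -
      obtain i where "tentative q s a i \<noteq> a i" using assms(3) by blast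
      then show ?thesis using less[of i] by blast
    qed
  qed simp
qed

lemma da_stable:
  fixes pr :: "('i::finite, 'c::finite) profile"
  assumes pr: "preference_profile pr"
  shows "tentative q s (da q s pr) = da q s pr" and "da_invariant q s pr (da q s pr)"
proof -
  define a where "a = while (\<lambda>a. tentative q s a \<noteq> a) (da_step q s pr) (\<lambda>i. best (pr i) UNIV)"
  have "da_invariant q s pr a \<and> tentative q s a = a"
    unfolding a_def
  proof (rule while_rule[where P = "da_invariant q s pr" and
        r = "inv_image less_than (\<lambda>a. \<Sum>i\<in>UNIV. card {x. (a i, x) \<in> pr i})"])
    show "da_invariant q s pr (\<lambda>i. best (pr i) UNIV)"
      by (rule da_invariant_initial[OF pr])
    show "da_invariant q s pr (da_step q s pr a)" if "da_invariant q s pr a" for a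
      by (rule da_invariant_step[OF pr that])
    show "(da_step q s pr a, a) \<in> inv_image less_than (\<lambda>a. \<Sum>i\<in>UNIV. card {x. (a i, x) \<in> pr i})"
      if "da_invariant q s pr a" "tentative q s a \<noteq> a" for a
      using da_step_decreases[OF pr that] by simp
  qed (auto intro: wf_inv_image)
  \<comment> \<open>At exit nobody is rejected, so the final \<open>tentative\<close> changes
    nothing: the outcome is the last application profile, and the invariant applies to it.\<close>
  moreover have "da q s pr = tentative q s a"
    by (simp add: da_def a_def)
  ultimately show "tentative q s (da q s pr) = da q s pr" "da_invariant q s pr (da q s pr)"
    by auto
qed

section \<open>Feasibility, non-wastefulness and absence of justified envy for the DA
  outcome\<close>

lemma da_acceptable:
  fixes pr :: "('i::finite, 'c::finite) profile"
  assumes "preference_profile pr" "da q s pr i = Some c"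
  shows "(Some c, None) \<in> pr i"
proof -
  have "weakly_prefers (pr i) (da q s pr i) None"
    by (rule da_invariantD(1)[OF da_stable(2)[OF assms(1)]])
  then show ?thesis using assms(2) by (simp add: weakly_prefers_def)
qed

lemma da_within_capacity:
  fixes pr :: "('i::finite, 'c::finite) profile"
  assumes "preference_profile pr" "da q s pr i = Some c"
  shows "card {j. da q s pr j = Some c \<and> s j > s i} < q c"
  using da_stable(1)[OF assms(1), of q s] assms(2) tentative_eq_Some_iff[of q s "da q s pr" i c]
  by simp

lemma da_nonwasteful:
  fixes pr :: "('i::finite, 'c::finite) profile"
  assumes "preference_profile pr" "(Some c, da q s pr i) \<in> pr i"
  shows "q c \<le> card {j. da q s pr j = Some c \<and> s j > s i}"
  by (rule da_invariantD(2)[OF da_stable(2)[OF assms(1)] assms(2)])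

text \<open>If \<open>s i \<le> s j\<close>, the students at \<open>c\<close> above \<open>j\<close>
  are also above \<open>i\<close>. The preference of \<open>j\<close> for \<open>c\<close> forces at
  least \<open>q c\<close> of them, which leaves no seat for \<open>i\<close>.\<close>

lemma da_no_justified_envy:
  fixes pr :: "('i::finite, 'c::finite) profile"
  assumes pr: "preference_profile pr"
    and "(Some c, da q s pr j) \<in> pr j" "da q s pr i = Some c"
  shows "s j < s i"
proof (rule ccontr)
  assume "\<not> s j < s i"
  then have "card {k. da q s pr k = Some c \<and> s k > s j} \<le> card {k. da q s pr k = Some c \<and> s k > s i}"
    by (intro card_mono) auto
  then show False
    using da_within_capacity[OF pr assms(3)] da_nonwasteful[OF pr assms(2)] by simp
qed

text \<open>An unassigned student would prefer every college to her outcome, so by non-wastefulness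
  all seats would be filled by the other students, who are too few.\<close>

lemma da_all_assigned:
  fixes pr :: "('i::finite, 'c::finite) profile"
  assumes pr: "preference_profile pr" and acc: "\<And>c. acceptable (pr i) c"
    and cap: "(\<Sum>c\<in>UNIV. q c) \<ge> CARD('i)"
  shows "da q s pr i \<noteq> None"
proof
  assume None: "da q s pr i = None"
  have full: "q c \<le> card {j. da q s pr j = Some c}" for c
  proof -
    have "q c \<le> card {j. da q s pr j = Some c \<and> s j > s i}"
      using acc None by (intro da_nonwasteful[OF pr]) (simp add: acceptable_def)
    also have "\<dots> \<le> card {j. da q s pr j = Some c}" by (intro card_mono) auto
    finally show ?thesis .
  qed
  have "CARD('i) \<le> (\<Sum>c\<in>UNIV. card {j. da q s pr j = Some c})"
    using cap sum_mono[of UNIV q "\<lambda>c. card {j. da q s pr j = Some c}"] full by simp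
  also have "\<dots> = card (\<Union>c\<in>UNIV. {j. da q s pr j = Some c})"
    by (subst card_UN_disjoint) auto
  also have "\<dots> < CARD('i)"
  proof (rule psubset_card_mono)
    have "i \<notin> (\<Union>c\<in>UNIV. {j. da q s pr j = Some c})" using None by simp
    then show "(\<Union>c\<in>UNIV. {j. da q s pr j = Some c}) \<subset> UNIV" by blast
  qed simp
  finally show False by simp
qed

subsection \<open>TCDM compared with deferred acceptance\<close>

text \<open>The central counting step. A higher-scored applicant \<open>j\<close> of
  \<open>c\<close> who has another DA assignment would strictly prefer \<open>c\<close> and so envy
  \<open>i\<close> with justification. Hence all such applicants hold seats at \<open>c\<close>
  under DA, together with \<open>i\<close>.\<close>

lemma da_college_not_overdemanded:
  fixes pr :: "('i::finite, 'c::finite) profile"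
  assumes pr: "preference_profile pr"
    and a: "\<And>j. weakly_prefers (pr j) (a j) (da q s pr j)"
    and c: "da q s pr i = Some c"
  shows "card {j. a j = Some c \<and> s j > s i} < q c"
proof -
  have "da q s pr j = Some c" if "a j = Some c" "s j > s i" for j
    using a[of j] da_no_justified_envy[OF pr _ c, of j] that by (auto simp: weakly_prefers_def)
  then have "card {j. a j = Some c \<and> s j > s i} \<le> card {j. da q s pr j = Some c \<and> s j > s i}"
    by (intro card_mono) auto
  then show ?thesis using da_within_capacity[OF pr c] by simp
qed

text \<open>A cutoff above \<open>s i\<close> would mean that \<open>q c\<close> held applicants
  outrank \<open>i\<close>, against the preceding count.\<close>

lemma cutoff_da_college:
  fixes pr :: "('i::finite, 'c::finite) profile"
  assumes pr: "preference_profile pr" and q: "q c > 0" and s: "s i \<ge> 0"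
    and a: "\<And>j. weakly_prefers (pr j) (a j) (da q s pr j)"
    and c: "da q s pr i = Some c"
  shows "cutoff q s (tentative q s a) c \<le> s i"
proof (rule ccontr)
  let ?M = "{j. tentative q s a j = Some c}"
  assume *: "\<not> cutoff q s (tentative q s a) c \<le> s i"
  \<comment> \<open>A college that is not full has cutoff 0, which cannot exceed a nonnegative
    score.\<close>
  with s have card: "card ?M = q c" by (auto simp: cutoff_def split: if_splits)
  have "cutoff q s (tentative q s a) c = Min (s ` ?M)" using card by (simp add: cutoff_def)
  then have "s i < Min (s ` ?M)" using * by linarith
  moreover have "Min (s ` ?M) \<le> s j" if "j \<in> ?M" for j
    using that by (intro Min_le) auto
  ultimately have "s j > s i" if "j \<in> ?M" for j
    using that by (meson less_le_trans)
  then have "card ?M \<le> card {j. a j = Some c \<and> s j > s i}"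
    by (intro card_mono) (auto simp: tentative_eq_Some_iff)
  then show False
    using card da_college_not_overdemanded[OF pr a c] by simp
qed

text \<open>Here \<open>t\<close> counts completed rounds, so the application is that of round
  \<open>t + 1\<close>. A held student repeats her application and inherits the bound; an unassigned
  one still finds her DA college among the options open to her.\<close>

lemma tcdm_application_weakly_prefers_da:
  fixes pr :: "('i::finite, 'c::finite) profile"
  assumes pr: "preference_profile pr" and q: "\<And>c. q c > 0" and s: "\<And>i. s i \<ge> 0"
  shows "weakly_prefers (pr i)
    (straightforward q s (pr i) i
      (tcdm_history q s (\<lambda>i. straightforward q s (pr i) i) t)) (da q s pr i)"
proof (induction t arbitrary: i)
  case 0
  have "strict_linear_order_on UNIV (pr i)" using pr by (simp add: preference_profile_def)
  from best_greatest(2)[OF this, of "da q s pr i" UNIV] show ?case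
    by (cases "da q s pr i") auto
next
  case (Suc t)
  define a where "a i = straightforward q s (pr i) i
    (tcdm_history q s (\<lambda>i. straightforward q s (pr i) i) t)" for i
  have a: "weakly_prefers (pr j) (a j) (da q s pr j)" for j
    using Suc by (simp add: a_def)
  have r: "strict_linear_order_on UNIV (pr i)" using pr by (simp add: preference_profile_def)
  let ?B = "{c. s i \<ge> cutoff q s (tentative q s a) c}"
  \<comment> \<open>The induction hypothesis for all students is what
    \<open>cutoff_da_college\<close> needs to place the DA college of \<open>i\<close> in
    \<open>?B\<close>.\<close>
  have "weakly_prefers (pr i) (best (pr i) ?B) (da q s pr i)"
    by (rule best_greatest(2)[OF r])
      (use cutoff_da_college[OF pr q s a] in \<open>cases "da q s pr i"; auto\<close>)
  moreover have "a i = Some c" if "tentative q s a i = Some c" for c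
    using that by (simp add: tentative_eq_Some_iff)
  ultimately show ?case
    using a[of i] by (auto simp: a_def[symmetric] split: option.split)
qed

lemma tcdm_keeps_da_favourite:
  fixes pr :: "('i::finite, 'c::finite) profile"
  assumes pr: "preference_profile pr" and q: "\<And>c. q c > 0" and s: "\<And>i. s i \<ge> 0"
    and T: "T \<ge> 1"
    and c: "da q s pr i = Some c" and top: "\<And>d. (Some d, Some c) \<notin> pr i"
  shows "tcdm q s T pr i = Some c"
proof -
  \<comment> \<open>The last round's applications depend on the \<open>T - 1\<close> earlier
    matchings; \<open>T \<ge> 1\<close> ensures that \<open>hd\<close> is taken of a nonempty
    history.\<close>
  define a where "a i = straightforward q s (pr i) i
    (tcdm_history q s (\<lambda>i. straightforward q s (pr i) i) (T - 1))" for i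
  have a: "weakly_prefers (pr j) (a j) (da q s pr j)" for j
    unfolding a_def by (rule tcdm_application_weakly_prefers_da[OF pr q s])
  have "tcdm q s T pr = tentative q s a"
    using T by (cases T) (simp_all add: tcdm_def a_def[abs_def])
  moreover have "(None, Some c) \<notin> pr i"
    using da_acceptable[OF pr c] pr
    unfolding preference_profile_def strict_linear_order_on_def by (metis irrefl_def transD)
  then have "a i = Some c"
    using a[of i] top c by (cases "a i") (auto simp: weakly_prefers_def)
  ultimately show ?thesis
    using da_college_not_overdemanded[OF pr a c] by (simp add: tentative_eq_Some_iff)
qed

subsection \<open>Assignment probabilities\<close>

lemma ranked_college_bij:
  fixes r :: "('c::finite) pref"
  assumes "strict_linear_order_on UNIV r"
  shows "bij_betw (ranked_college r) {1..CARD('c)} UNIV"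
    and "l \<in> {1..CARD('c)} \<Longrightarrow> card {d. (Some d, Some (ranked_college r l)) \<in> r} + 1 = l"
proof -
  have t: "trans r" and ir: "irrefl r" and tot: "total r"
    using assms by (auto simp: strict_linear_order_on_def)
  \<comment> \<open>\<open>rank\<close> counts only colleges, not the outside option, and turns out
    to be the inverse of \<open>ranked_college\<close>.\<close>
  define rank where "rank c = card {d. (Some d, Some c) \<in> r} + 1" for c
  have less: "rank c < rank d" if "(Some c, Some d) \<in> r" for c d
  proof -
    have "{e. (Some e, Some c) \<in> r} \<subset> {e. (Some e, Some d) \<in> r}"
    proof
      show "{e. (Some e, Some c) \<in> r} \<subseteq> {e. (Some e, Some d) \<in> r}"
        using that t by (blast dest: transD)
      show "{e. (Some e, Some c) \<in> r} \<noteq> {e. (Some e, Some d) \<in> r}"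
        using that ir by (auto simp: irrefl_def)
    qed
    then show ?thesis unfolding rank_def by (simp add: psubset_card_mono)
  qed
  have inj: "inj rank"
  proof (rule injI, rule ccontr)
    fix c d assume "rank c = rank d" "c \<noteq> d"
    moreover have "(Some c, Some d) \<in> r \<or> (Some d, Some c) \<in> r"
      using tot \<open>c \<noteq> d\<close> by (simp add: total_on_def)
    ultimately show False using less[of c d] less[of d c] by auto
  qed
  have "rank c \<in> {1..CARD('c)}" for c
  proof -
    have "card {d. (Some d, Some c) \<in> r} < CARD('c)"
      using ir by (intro psubset_card_mono) (auto simp: irrefl_def)
    then show ?thesis by (simp add: rank_def)
  qed
  \<comment> \<open>An injection into a finite set of the same size is onto.\<close>
  then have "range rank = {1..CARD('c)}"
    using inj by (intro card_subset_eq) (auto simp: card_image)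
  with inj have bij: "bij_betw rank UNIV {1..CARD('c)}" by (simp add: bij_betw_def)
  have eq: "ranked_college r l = (THE c. rank c = l)" for l
    by (simp add: ranked_college_def rank_def)
  have left: "ranked_college r (rank c) = c" for c
    unfolding eq using inj by (auto dest: injD)
  have right: "rank (ranked_college r l) = l" if "l \<in> {1..CARD('c)}" for l
    using bij that left by (metis bij_betw_def imageE)
  show "bij_betw (ranked_college r) {1..CARD('c)} UNIV"
    using left right \<open>\<And>c. rank c \<in> {1..CARD('c)}\<close>
    by (intro bij_betw_byWitness[where f' = rank]) auto
  show "card {d. (Some d, Some (ranked_college r l)) \<in> r} + 1 = l" if "l \<in> {1..CARD('c)}"
    using right[OF that] by (simp add: rank_def)
qed

text \<open>Being assigned splits into disjoint events according to the rank of the assigned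
  college.\<close>

lemma sum_rank_prob:
  fixes P :: "('i, 'c::finite) profile pmf"
  assumes "\<And>pr. pr \<in> set_pmf P \<Longrightarrow> preference_profile pr"
  shows "(\<Sum>l = 1..CARD('c). rank_prob P M i l) = 1 - unassigned_prob P M i"
proof -
  \<comment> \<open>Restricting to the support keeps the events disjoint: for a relation that is not
    a linear order, \<open>ranked_college\<close> may give two ranks the same college.\<close>
  define E where "E l = {pr \<in> set_pmf P. M pr i = Some (ranked_college (pr i) l)}" for l
  have bij: "bij_betw (ranked_college (pr i)) {1..CARD('c)} UNIV" if "pr \<in> set_pmf P" for pr
    using assms[OF that] by (intro ranked_college_bij) (simp add: preference_profile_def)
  have "rank_prob P M i l = measure_pmf.prob P (E l)" for l
    unfolding rank_prob_def E_def
    by (intro measure_pmf.finite_measure_eq_AE) (auto simp: AE_measure_pmf_iff)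
  moreover have "disjoint_family_on E {1..CARD('c)}"
    unfolding disjoint_family_on_def
  proof (intro ballI impI)
    fix k l assume kl: "k \<in> {1..CARD('c)}" "l \<in> {1..CARD('c)}" "k \<noteq> l"
    show "E k \<inter> E l = {}"
    proof (rule ccontr)
      assume "E k \<inter> E l \<noteq> {}"
      then obtain pr where pr: "pr \<in> set_pmf P" "ranked_college (pr i) k = ranked_college (pr i) l"
        unfolding E_def by (metis (mono_tags, lifting) Int_emptyI mem_Collect_eq option.inject)
      then show False using bij[OF pr(1)] kl by (meson bij_betw_imp_inj_on inj_onD)
    qed
  qed
  ultimately have "(\<Sum>l = 1..CARD('c). rank_prob P M i l) = measure_pmf.prob P (\<Union>l\<in>{1..CARD('c)}. E l)"
    by (subst measure_pmf.finite_measure_finite_Union) auto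
  also have "\<dots> = measure_pmf.prob P (- {pr. M pr i = None})"
  proof (rule measure_pmf.finite_measure_eq_AE)
    have "(pr \<in> (\<Union>l\<in>{1..CARD('c)}. E l)) = (pr \<in> - {pr. M pr i = None})"
      if pr: "pr \<in> set_pmf P" for pr
    proof (cases "M pr i")
      case None
      then show ?thesis by (simp add: E_def)
    next
      case (Some c)
      then obtain l where "l \<in> {1..CARD('c)}" "c = ranked_college (pr i) l"
        using bij[OF pr] by (metis UNIV_I bij_betw_def imageE)
      then have "pr \<in> E l" using Some pr by (simp add: E_def)
      then show ?thesis using Some \<open>l \<in> {1..CARD('c)}\<close> by auto
    qed
    then show "AE pr in measure_pmf P. (pr \<in> (\<Union>l\<in>{1..CARD('c)}. E l)) = (pr \<in> - {pr. M pr i = None})"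
      by (simp add: AE_measure_pmf_iff)
  qed auto
  also have "\<dots> = 1 - unassigned_prob P M i"
    unfolding unassigned_prob_def using measure_pmf.prob_compl[of "{pr. M pr i = None}" P]
    by (simp add: Compl_eq_Diff_UNIV)
  finally show ?thesis .
qed

theorem proposition3:
  fixes q :: "'c::finite \<Rightarrow> nat"
    and s :: "'i::finite \<Rightarrow> real"
    and T :: nat
    and D :: "('i, 'c) profile set"
    and P :: "('i, 'c) profile pmf"
  assumes "\<And>c. q c > 0"
    and "\<And>i. s i > 0"
    and "inj s"
    and "T \<ge> 1"
    and "\<And>pr. pr \<in> D \<Longrightarrow> preference_profile pr"
    and "set_pmf P \<subseteq> D"
  shows "(\<forall>i. unconstrained q s D T i \<longrightarrow>
              (\<forall>l \<in> {1..CARD('c)}. rank_prob P (tcdm q s T) i l = rank_prob P (da q s) i l) \<and>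
              unassigned_prob P (tcdm q s T) i = unassigned_prob P (da q s) i)
       \<and> (\<forall>i. rank_prob P (tcdm q s T) i 1 \<ge> rank_prob P (da q s) i 1)
       \<and> ((\<forall>pr \<in> D. \<forall>i c. acceptable (pr i) c) \<and> (\<Sum>c\<in>UNIV. q c) \<ge> CARD('i) \<longrightarrow>
            (\<forall>i. unassigned_prob P (tcdm q s T) i \<ge> unassigned_prob P (da q s) i \<and>
                 unassigned_prob P (da q s) i = 0) \<and>
            (\<forall>i. (\<Sum>l = 2..CARD('c). rank_prob P (tcdm q s T) i l)
                 \<le> (\<Sum>l = 2..CARD('c). rank_prob P (da q s) i l)))"
proof -
  have pp: "preference_profile pr" if "pr \<in> set_pmf P" for pr
    using that assms(5,6) by blast
  have s0: "s i \<ge> 0" for i using assms(2)[of i] by simp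
  have ae: "measure_pmf.prob P A = measure_pmf.prob P B"
    if "\<And>pr. pr \<in> set_pmf P \<Longrightarrow> pr \<in> A \<longleftrightarrow> pr \<in> B" for A B
    using that by (intro measure_pmf.finite_measure_eq_AE) (auto simp: AE_measure_pmf_iff)
  have 1: "(\<forall>l \<in> {1..CARD('c)}. rank_prob P (tcdm q s T) i l = rank_prob P (da q s) i l) \<and>
      unassigned_prob P (tcdm q s T) i = unassigned_prob P (da q s) i"
    if "unconstrained q s D T i" for i
  proof -
    have "tcdm q s T pr i = da q s pr i" if "pr \<in> set_pmf P" for pr
      using that \<open>unconstrained q s D T i\<close> assms(6) by (auto simp: unconstrained_def)
    then show ?thesis
      unfolding rank_prob_def unassigned_prob_def by (intro conjI ballI ae) simp_all
  qed
  have 2: "rank_prob P (da q s) i 1 \<le> rank_prob P (tcdm q s T) i 1" for i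
    unfolding rank_prob_def
  proof (rule measure_pmf.finite_measure_mono_AE)
    have "tcdm q s T pr i = Some (ranked_college (pr i) 1)"
      if pr: "pr \<in> set_pmf P" and da: "da q s pr i = Some (ranked_college (pr i) 1)" for pr
    proof (rule tcdm_keeps_da_favourite[OF pp[OF pr] assms(1) s0 assms(4) da])
      fix d
      \<comment> \<open>Rank 1 leaves no college above, which is the favourite condition of
        \<open>tcdm_keeps_da_favourite\<close>.\<close>
      have "card {d. (Some d, Some (ranked_college (pr i) 1)) \<in> pr i} + 1 = 1"
        using pp[OF pr] by (intro ranked_college_bij(2)) (auto simp: preference_profile_def Suc_le_eq)
      then have "{d. (Some d, Some (ranked_college (pr i) 1)) \<in> pr i} = {}" by simp
      then show "(Some d, Some (ranked_college (pr i) 1)) \<notin> pr i" by blast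
    qed
    then show "AE pr in measure_pmf P.
        pr \<in> {pr. da q s pr i = Some (ranked_college (pr i) 1)} \<longrightarrow>
        pr \<in> {pr. tcdm q s T pr i = Some (ranked_college (pr i) 1)}"
      by (simp add: AE_measure_pmf_iff)
  qed simp
  have 3: "unassigned_prob P (da q s) i = 0"
    if "\<forall>pr \<in> D. \<forall>i c. acceptable (pr i) c" "(\<Sum>c\<in>UNIV. q c) \<ge> CARD('i)" for i
  proof -
    have "da q s pr i \<noteq> None" if "pr \<in> set_pmf P" for pr
      using that assms(6) \<open>\<forall>pr \<in> D. \<forall>i c. acceptable (pr i) c\<close>
      by (intro da_all_assigned[OF pp[OF that] _ \<open>(\<Sum>c\<in>UNIV. q c) \<ge> CARD('i)\<close>]) blast
    then have "unassigned_prob P (da q s) i = measure_pmf.prob P {}"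
      unfolding unassigned_prob_def by (intro ae) simp
    then show ?thesis by simp
  qed
  \<comment> \<open>The total over all ranks is known, so splitting off rank 1 reduces the tail
    comparison to the first-choice and unassigned probabilities.\<close>
  have tail: "(\<Sum>l = 2..CARD('c). rank_prob P M i l)
      = 1 - unassigned_prob P M i - rank_prob P M i 1" for M :: "('i, 'c) profile \<Rightarrow> ('i, 'c) assignment" and i
    using sum_rank_prob[of P M i] pp sum.atLeast_Suc_atMost[of 1 "CARD('c)" "rank_prob P M i"]
    by (simp add: numeral_2_eq_2 Suc_le_eq)
  have nonneg: "unassigned_prob P M i \<ge> 0" for M :: "('i, 'c) profile \<Rightarrow> ('i, 'c) assignment" and i
    by (simp add: unassigned_prob_def)
  have 4: "(\<Sum>l = 2..CARD('c). rank_prob P (tcdm q s T) i l)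
      \<le> (\<Sum>l = 2..CARD('c). rank_prob P (da q s) i l)"
    if "unassigned_prob P (da q s) i = 0" for i
    unfolding tail using that 2[of i] nonneg[of "tcdm q s T" i] by linarith
  show ?thesis using 1 2 3 4 nonneg by auto
qed

end
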